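(* Let $\mathbf c\in\mathbb Z_{\ge0}^n$ and let $M$ be a proper $\mathbf c$-multicomplex. Then (i) $h_i(\mathcal B_{\mathbf c}(M))=f_i(M)$ for all $i$; (ii) $g_i(\mathrm{Bier}_{\mathbf c}(M))=f_i(M)-f_{|\mathbf c|-i}(M)$ for $i=0,1,\dots,\lfloor(|\mathbf c|-1)/2\rfloor$.
   Context: Fix $\mathbf c=(c_1,\dots,c_n)\in\mathbb Z_{\ge0}^n$, $|\mathbf c|=c_1+\cdots+c_n$, and write $x^{\mathbf a}=x_1^{a_1}\cdots x_n^{a_n}$. A $\mathbf c$-monomial is $x^{\mathbf a}$ with $a_i\le c_i$ for all $i$. A $\mathbf c$-multicomplex is a nonempty set $M$ of $\mathbf c$-monomials closed under taking divisors; it is proper if it is not the set of all $\mathbf c$-monomials. $f_i(M)$ denotes the number of monomials of degree $i$ in $M$. Let $\widetilde X=\{x_i^{(j)}:1\le i\le n,\ 0\le j\le c_i\}$ (new symbols). For a $\mathbf c$-monomial $x^{\mathbf a}$ put $F_{\mathbf c}(x^{\mathbf a})=\widetilde X\setminus\{x_1^{(a_1)},\dots,x_n^{(a_n)}\}$; $\mathcal B_{\mathbf c}(M)$ is the simplicial complex consisting of all subsets of the sets $F_{\mathbf c}(x^{\mathbf a})$, $x^{\mathbf a}\in M$ (it has dimension $|\mathbf c|-1$). For a pure $(d-1)$-dimensional complex $B$, $\partial B$ is the complex generated by the $(d-1)$-element faces lying in exactly one facet. For proper $M$, $\mathrm{Bier}_{\mathbf c}(M)=\partial\mathcal B_{\mathbf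 c}(M)$ (of dimension $|\mathbf c|-2$). For a $(d-1)$-dimensional simplicial complex $\Delta$ with $f_i$ faces of cardinality $i$ ($f_0=1$), the $h$-vector $(h_0,\dots,h_d)$ is defined by $\sum_{i=0}^d h_it^{d-i}=\sum_{i=0}^d f_i(t-1)^{d-i}$, and the $g$-vector by $g_0=1$, $g_i=h_i-h_{i-1}$ for $1\le i\le\lfloor d/2\rfloor$. *)

theory Defs
  imports Complex_Main "HOL-Computational_Algebra.Polynomial"
begin

section \<open>Multicomplexes\<close>

text \<open>A monomial in the variables \<open>x\<^sub>1, \<dots>, x\<^sub>n\<close> is represented by its exponent vector
  \<open>a :: nat \<Rightarrow> nat\<close>, normalised to be \<open>0\<close> outside \<open>{1..n}\<close>, so that distinct vectors are
  distinct monomials and \<open>x\<^sup>b\<close> divides \<open>x\<^sup>a\<close> iff \<open>b i \<le> a i\<close> for all \<open>i\<close>.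
  Only the values of \<open>c\<close> on \<open>{1..n}\<close> are ever used.\<close>

definition monom_deg :: "nat \<Rightarrow> (nat \<Rightarrow> nat) \<Rightarrow> nat" where
  "monom_deg n a = (\<Sum>i=1..n. a i)"

definition c_monomials :: "nat \<Rightarrow> (nat \<Rightarrow> nat) \<Rightarrow> (nat \<Rightarrow> nat) set" where
  "c_monomials n c = {a. (\<forall>i\<in>{1..n}. a i \<le> c i) \<and> (\<forall>i. i \<notin> {1..n} \<longrightarrow> a i = 0)}"

definition monom_dvd :: "(nat \<Rightarrow> nat) \<Rightarrow> (nat \<Rightarrow> nat) \<Rightarrow> bool" where
  "monom_dvd b a \<longleftrightarrow> (\<forall>i. b i \<le> a i)"

definition c_multicomplex :: "nat \<Rightarrow> (nat \<Rightarrow> nat) \<Rightarrow> (nat \<Rightarrow> nat) set \<Rightarrow> bool" where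
  "c_multicomplex n c M \<longleftrightarrow>
     M \<noteq> {} \<and> M \<subseteq> c_monomials n c \<and> (\<forall>a\<in>M. \<forall>b. monom_dvd b a \<longrightarrow> b \<in> M)"

definition proper_c_multicomplex :: "nat \<Rightarrow> (nat \<Rightarrow> nat) \<Rightarrow> (nat \<Rightarrow> nat) set \<Rightarrow> bool" where
  "proper_c_multicomplex n c M \<longleftrightarrow> c_multicomplex n c M \<and> M \<noteq> c_monomials n c"

definition f_multi :: "nat \<Rightarrow> (nat \<Rightarrow> nat) set \<Rightarrow> nat \<Rightarrow> nat" where
  "f_multi n M i = card {a \<in> M. monom_deg n a = i}"


section \<open>Simplicial complexes\<close>

text \<open>A simplicial complex is represented by its set of faces, including the empty face.
  All complexes below are finite.\<close>

definition generated_complex :: "'v set set \<Rightarrow> 'v set set" where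
  "generated_complex \<F> = {S. \<exists>F\<in>\<F>. S \<subseteq> F}"

definition facets :: "'v set set \<Rightarrow> 'v set set" where
  "facets \<Delta> = {F \<in> \<Delta>. \<not> (\<exists>G\<in>\<Delta>. F \<subset> G)}"

text \<open>The number \<open>d\<close> for which \<open>\<Delta>\<close> is \<open>(d - 1)\<close>-dimensional.\<close>

definition complex_rank :: "'v set set \<Rightarrow> nat" where
  "complex_rank \<Delta> = Max (card ` \<Delta>)"

text \<open>The boundary is meant for pure complexes of rank at least 1; the equation
  \<open>card S + 1 = d\<close> avoids truncated subtraction.\<close>

definition boundary_complex :: "'v set set \<Rightarrow> 'v set set" where
  "boundary_complex \<Delta> = generated_complex
     {S \<in> \<Delta>. card S + 1 = complex_rank \<Delta> \<and> (\<exists>!F. F \<in> facets \<Delta> \<and> S \<subseteq> F)}"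

definition f_vec :: "'v set set \<Rightarrow> nat \<Rightarrow> nat" where
  "f_vec \<Delta> i = card {S \<in> \<Delta>. card S = i}"

text \<open>\<open>h\<^sub>i\<close> is the coefficient of \<open>t\<^bsup>d-i\<^esup>\<close> in \<open>\<Sum>\<^sub>i f\<^sub>i (t - 1)\<^bsup>d-i\<^esup>\<close>, extended by \<open>0\<close> for \<open>i > d\<close>.\<close>

definition h_poly :: "'v set set \<Rightarrow> int poly" where
  "h_poly \<Delta> = (\<Sum>i=0..complex_rank \<Delta>.
     of_nat (f_vec \<Delta> i) * [:-1, 1:] ^ (complex_rank \<Delta> - i))"

definition h_vec :: "'v set set \<Rightarrow> nat \<Rightarrow> int" where
  "h_vec \<Delta> i = (if i \<le> complex_rank \<Delta> then coeff (h_poly \<Delta>) (complex_rank \<Delta> - i) else 0)"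

lemma degree_h_poly_le: "degree (h_poly \<Delta>) \<le> complex_rank \<Delta>"
  unfolding h_poly_def
proof (rule degree_sum_le)
  fix i assume "i \<in> {0..complex_rank \<Delta>}"
  have "degree (of_nat (f_vec \<Delta> i) * [:-1, 1:] ^ (complex_rank \<Delta> - i) :: int poly)
      \<le> 0 + 1 * (complex_rank \<Delta> - i)"
    by (rule order_trans[OF degree_mult_le], rule add_mono)
       (simp, rule order_trans[OF degree_power_le], simp)
  then show "degree (of_nat (f_vec \<Delta> i) * [:-1, 1:] ^ (complex_rank \<Delta> - i) :: int poly)
      \<le> complex_rank \<Delta>" by simp
qed simp

lemma h_vec_defining_identity:
  "(\<Sum>i=0..complex_rank \<Delta>. monom (h_vec \<Delta> i) (complex_rank \<Delta> - i)) =
   (\<Sum>i=0..complex_rank \<Delta>. of_nat (f_vec \<Delta> i) * [:-1, 1:] ^ (complex_rank \<Delta> - i))"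
proof -
  let ?d = "complex_rank \<Delta>"
  have "(\<Sum>i=0..?d. monom (h_vec \<Delta> i) (?d - i)) =
        (\<Sum>i=0..?d. monom (coeff (h_poly \<Delta>) (?d - i)) (?d - i))"
    by (rule sum.cong) (auto simp: h_vec_def)
  also have "\<dots> = (\<Sum>i\<le>?d. monom (coeff (h_poly \<Delta>) i) i)"
    by (rule sum.reindex_bij_witness[of _ "\<lambda>i. ?d - i" "\<lambda>i. ?d - i"]) auto
  also have "\<dots> = h_poly \<Delta>"
    by (rule poly_as_sum_of_monoms'[OF degree_h_poly_le])
  finally show ?thesis by (simp add: h_poly_def)
qed

text \<open>Meaningful only for \<open>i \<le> complex_rank \<Delta> div 2\<close>.\<close>

definition g_vec :: "'v set set \<Rightarrow> nat \<Rightarrow> int" where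
  "g_vec \<Delta> i = (if i = 0 then 1 else h_vec \<Delta> i - h_vec \<Delta> (i - 1))"


section \<open>Bier balls and Bier spheres\<close>

text \<open>The vertex \<open>x\<^sub>i\<^bsup>(j)\<^esup>\<close> is the pair \<open>(i, j)\<close>.\<close>

definition X_tilde :: "nat \<Rightarrow> (nat \<Rightarrow> nat) \<Rightarrow> (nat \<times> nat) set" where
  "X_tilde n c = {(i, j). i \<in> {1..n} \<and> j \<le> c i}"

definition F_face :: "nat \<Rightarrow> (nat \<Rightarrow> nat) \<Rightarrow> (nat \<Rightarrow> nat) \<Rightarrow> (nat \<times> nat) set" where
  "F_face n c a = X_tilde n c - (\<lambda>i. (i, a i)) ` {1..n}"

definition bier_ball :: "nat \<Rightarrow> (nat \<Rightarrow> nat) \<Rightarrow> (nat \<Rightarrow> nat) set \<Rightarrow> (nat \<times> nat) set set" where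
  "bier_ball n c M = generated_complex (F_face n c ` M)"

definition Bier :: "nat \<Rightarrow> (nat \<Rightarrow> nat) \<Rightarrow> (nat \<Rightarrow> nat) set \<Rightarrow> (nat \<times> nat) set set" where
  "Bier n c M = boundary_complex (bier_ball n c M)"

end

theory Submission
  imports Defs
begin

text \<open>Write \<open>d = |c|\<close>. Recording for each face of the ball the smallest missing vertex of every
  column \<open>{(i, 0), \<dots>, (i, c i)}\<close> partitions the ball into the intervals
  \<open>[lower_face a, F_face a]\<close>, \<open>a \<in> M\<close>, so that the sum of \<open>(t - 1)\<^bsup>d - |S|\<^esup>\<close> over its faces is
  \<open>\<Sum>\<^sub>a t\<^bsup>d - deg a\<^esup>\<close>. Recording the largest missing vertices instead, the faces whose record
  lies in \<open>M\<close> are exactly those off the boundary; they are partitioned into the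
  intervals \<open>[upper_face a, F_face a]\<close> and contribute \<open>\<Sum>\<^sub>a t\<^bsup>deg a\<^esup>\<close>. The difference of the two
  sums is \<open>t - 1\<close> times the \<open>h\<close>-polynomial of the boundary; this product has coefficients \<open>g\<^sub>i\<close>.\<close>

declare One_nat_def [simp del]

section \<open>Sums over intervals of faces and the h-polynomial\<close>

text \<open>Complementing in \<open>F\<close> turns the sum into one over all subsets of
  \<open>F - R\<close>, which is the expansion of a product of factors
  \<open>(x - 1) + 1\<close>.\<close>

lemma sum_interval_power:
  fixes x :: "'a::comm_ring_1"
  assumes "finite F" "R \<subseteq> F"
  shows "(\<Sum>S\<in>{R..F}. (x - 1) ^ (card F - card S)) = x ^ (card F - card R)"
proof -
  have fin: "finite (F - R)" using assms by simp
  have "(\<Sum>S\<in>{R..F}. (x - 1) ^ (card F - card S)) = (\<Sum>U\<in>Pow (F - R). (x - 1) ^ card U)"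
  proof (rule sum.reindex_bij_witness[of _ "\<lambda>U. F - U" "\<lambda>S. F - S"])
    fix S assume S: "S \<in> {R..F}"
    then have "card (F - S) = card F - card S"
      using assms(1) by (intro card_Diff_subset) (auto intro: finite_subset)
    then show "(x - 1) ^ card (F - S) = (x - 1) ^ (card F - card S)" by simp
  qed (use assms in auto)
  also have "\<dots> = (\<Prod>u\<in>F - R. (x - 1) + 1)"
    by (subst prod_add[OF fin]) simp
  also have "\<dots> = x ^ (card F - card R)"
    using assms by (simp add: card_Diff_subset finite_subset)
  finally show ?thesis .
qed

lemma h_poly_eq_sum_faces:
  assumes "finite \<Delta>"
  shows "h_poly \<Delta> = (\<Sum>S\<in>\<Delta>. [:-1, 1:] ^ (complex_rank \<Delta> - card S))"
proof -
  let ?d = "complex_rank \<Delta>"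
  have le: "card S \<le> ?d" if "S \<in> \<Delta>" for S
    unfolding complex_rank_def using assms that by simp
  have "(\<Sum>S\<in>\<Delta>. [:-1, 1:] ^ (?d - card S) :: int poly)
      = (\<Sum>i\<in>{0..?d}. \<Sum>S\<in>{S \<in> \<Delta>. card S = i}. [:-1, 1:] ^ (?d - card S))"
    using assms le by (intro sum.group[symmetric]) auto
  also have "\<dots> = h_poly \<Delta>"
    unfolding h_poly_def f_vec_def by (intro sum.cong) auto
  finally show ?thesis by simp
qed

lemma complex_rank_eqI:
  assumes "finite \<Delta>" "\<And>S. S \<in> \<Delta> \<Longrightarrow> card S \<le> d" "F \<in> \<Delta>" "card F = d"
  shows "complex_rank \<Delta> = d"
  unfolding complex_rank_def using assms by (intro Max_eqI) auto

section \<open>Candidate facets and the intervals below them\<close>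

text \<open>For a c-monomial \<open>a\<close> and a subset of \<open>F_face n c a\<close>,
  containing this set means that \<open>a\<close> records the first missing vertex of each
  column.\<close>

definition lower_face :: "nat \<Rightarrow> (nat \<Rightarrow> nat) \<Rightarrow> (nat \<times> nat) set" where
  "lower_face n a = (SIGMA i:{1..n}. {..<a i})"

definition upper_face :: "nat \<Rightarrow> (nat \<Rightarrow> nat) \<Rightarrow> (nat \<Rightarrow> nat) \<Rightarrow> (nat \<times> nat) set" where
  "upper_face n c a = (SIGMA i:{1..n}. {a i<..c i})"

lemma X_tilde_eq_Sigma: "X_tilde n c = (SIGMA i:{1..n}. {..c i})"
  by (auto simp: X_tilde_def)

lemma finite_X_tilde: "finite (X_tilde n c)"
  by (simp add: X_tilde_eq_Sigma)

lemma mem_F_face_iff: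
  "(i, j) \<in> F_face n c a \<longleftrightarrow> i \<in> {1..n} \<and> j \<le> c i \<and> j \<noteq> a i"
  by (auto simp: F_face_def X_tilde_def)

lemma finite_F_face: "finite (F_face n c a)"
  using finite_X_tilde by (simp add: F_face_def)

lemma finite_c_monomials: "finite (c_monomials n c)"
proof -
  \<comment> \<open>The sum of all \<open>c k\<close> bounds every exponent, so one finite range
    serves all coordinates, with \<open>0\<close> as the value elsewhere.\<close>
  have "c_monomials n c \<subseteq> {a. \<forall>i. (i \<in> {1..n} \<longrightarrow> a i \<in> {..\<Sum>k=1..n. c k}) \<and> (i \<notin> {1..n} \<longrightarrow> a i = 0)}"
    by (fastforce simp: c_monomials_def intro: order_trans[OF _ member_le_sum])
  then show ?thesis
    by (rule finite_subset) (rule finite_set_of_finite_funs, auto)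
qed

lemma card_F_face:
  assumes "a \<in> c_monomials n c"
  shows "card (F_face n c a) = (\<Sum>k=1..n. c k)"
proof -
  have sub: "(\<lambda>i. (i, a i)) ` {1..n} \<subseteq> X_tilde n c"
    using assms by (auto simp: X_tilde_def c_monomials_def)
  have "card ((\<lambda>i. (i, a i)) ` {1..n}) = n"
    by (subst card_image) (auto intro: inj_onI)
  moreover have "card (X_tilde n c) = (\<Sum>k=1..n. c k) + n"
    by (simp add: X_tilde_eq_Sigma sum_Suc)
  ultimately show ?thesis
    using sub by (simp add: F_face_def card_Diff_subset)
qed

lemma lower_face_subset_F_face:
  "a \<in> c_monomials n c \<Longrightarrow> lower_face n a \<subseteq> F_face n c a"
  by (force simp: lower_face_def mem_F_face_iff c_monomials_def)

lemma upper_face_subset_F_face: "upper_face n c a \<subseteq> F_face n c a"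
  by (auto simp: upper_face_def mem_F_face_iff)

lemma card_lower_face: "card (lower_face n a) = monom_deg n a"
  by (simp add: lower_face_def monom_deg_def)

lemma card_upper_face:
  assumes "a \<in> c_monomials n c"
  shows "card (upper_face n c a) = (\<Sum>k=1..n. c k) - monom_deg n a"
  using assms unfolding upper_face_def monom_deg_def
  by (subst sum_subtractf_nat[symmetric]) (auto simp: c_monomials_def)

lemma monom_deg_le:
  "a \<in> c_monomials n c \<Longrightarrow> monom_deg n a \<le> (\<Sum>k=1..n. c k)"
  unfolding monom_deg_def c_monomials_def by (intro sum_mono) auto

lemma eq_if_eq_on_columns:
  assumes "a \<in> c_monomials n c" "b \<in> c_monomials n c" "\<And>i. i \<in> {1..n} \<Longrightarrow> a i = b i"
  shows "a = b"
proof
  fix i show "a i = b i"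
    using assms by (cases "i \<in> {1..n}") (auto simp: c_monomials_def)
qed

text \<open>If \<open>a i < b i\<close>, then \<open>(i, a i)\<close> lies in
  \<open>lower_face n b\<close> and hence in \<open>S\<close>, yet \<open>S\<close> lies in
  \<open>F_face n c a\<close>, which omits it. The case \<open>b i < a i\<close> is
  symmetric.\<close>

lemma lower_intervals_disjoint:
  assumes "a \<in> c_monomials n c" "b \<in> c_monomials n c"
    and "S \<in> {lower_face n a..F_face n c a}" "S \<in> {lower_face n b..F_face n c b}"
  shows "a = b"
proof (rule eq_if_eq_on_columns[OF assms(1,2)])
  fix i assume i: "i \<in> {1..n}"
  have "(i, a i) \<notin> S" "(i, b i) \<notin> S"
    using assms(3,4) by (auto simp: mem_F_face_iff subset_iff)
  then have "(i, a i) \<notin> lower_face n b" "(i, b i) \<notin> lower_face n a"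
    using assms(3,4) by auto
  then show "a i = b i"
    using i by (auto simp: lower_face_def)
qed

lemma upper_intervals_disjoint:
  assumes "a \<in> c_monomials n c" "b \<in> c_monomials n c"
    and "S \<in> {upper_face n c a..F_face n c a}" "S \<in> {upper_face n c b..F_face n c b}"
  shows "a = b"
proof (rule eq_if_eq_on_columns[OF assms(1,2)])
  fix i assume i: "i \<in> {1..n}"
  have "(i, a i) \<notin> S" "(i, b i) \<notin> S"
    using assms(3,4) by (auto simp: mem_F_face_iff subset_iff)
  then have "(i, a i) \<notin> upper_face n c b" "(i, b i) \<notin> upper_face n c a"
    using assms(3,4) by auto
  moreover have "a i \<le> c i" "b i \<le> c i"
    using assms(1,2) i by (auto simp: c_monomials_def)
  ultimately show "a i = b i"
    using i by (auto simp: upper_face_def)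
qed

text \<open>In column \<open>i\<close> the set \<open>F_face n c a\<close> omits only
  \<open>(i, a i)\<close>, but the inclusion forces it to omit \<open>(i, b i)\<close> as
  well.\<close>

lemma F_face_subset_imp_eq:
  assumes "a \<in> c_monomials n c" "b \<in> c_monomials n c" "F_face n c a \<subseteq> F_face n c b"
  shows "a = b"
proof (rule eq_if_eq_on_columns[OF assms(1,2)])
  fix i assume i: "i \<in> {1..n}"
  then have "b i \<le> c i" using assms(2) by (simp add: c_monomials_def)
  moreover have "(i, b i) \<notin> F_face n c a"
    using assms(3) mem_F_face_iff by blast
  ultimately show "a i = b i"
    using i by (auto simp: mem_F_face_iff)
qed

section \<open>Interval partitions and the h-vector of the ball\<close>

locale multicomplex =
  fixes n :: nat and c :: "nat \<Rightarrow> nat" and M :: "(nat \<Rightarrow> nat) set"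
  assumes multicomplex: "c_multicomplex n c M"
begin

abbreviation total :: nat where "total \<equiv> \<Sum>k=1..n. c k"

abbreviation ball :: "(nat \<times> nat) set set" where "ball \<equiv> bier_ball n c M"

text \<open>Built from the upper intervals so that face sums over it can be evaluated;
  \<open>Bier_eq\<close> later shows that it consists of the faces of the ball off the
  boundary.\<close>

definition interior :: "(nat \<times> nat) set set" where
  "interior = (\<Union>a\<in>M. {upper_face n c a..F_face n c a})"

lemma M_nonempty: "M \<noteq> {}"
  and M_c_monomials: "a \<in> M \<Longrightarrow> a \<in> c_monomials n c"
  and M_divisor_closed: "a \<in> M \<Longrightarrow> (\<And>i. b i \<le> a i) \<Longrightarrow> b \<in> M"
  using multicomplex by (auto simp: c_multicomplex_def monom_dvd_def)

lemma finite_M: "finite M"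
  using finite_c_monomials M_c_monomials by (metis finite_subset subsetI)

lemma mem_ball_iff: "S \<in> ball \<longleftrightarrow> (\<exists>a\<in>M. S \<subseteq> F_face n c a)"
  by (auto simp: bier_ball_def generated_complex_def)

lemma finite_ball: "finite ball"
proof -
  have "ball \<subseteq> Pow (X_tilde n c)"
    by (auto simp: mem_ball_iff F_face_def)
  then show ?thesis
    using finite_X_tilde by (metis finite_Pow_iff finite_subset)
qed

lemma card_le_total: "S \<in> ball \<Longrightarrow> card S \<le> total"
  by (metis mem_ball_iff card_mono finite_F_face card_F_face M_c_monomials)

lemma complex_rank_ball: "complex_rank ball = total"
proof -
  obtain a where a: "a \<in> M" using M_nonempty by blast
  then have "F_face n c a \<in> ball" by (auto simp: mem_ball_iff)
  then show ?thesis
    using a finite_ball card_le_total card_F_face M_c_monomials by (intro complex_rank_eqI) auto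
qed

lemma facets_ball: "facets ball = F_face n c ` M"
proof (intro set_eqI iffI)
  fix F assume "F \<in> facets ball"
  then have F: "F \<in> ball" "\<not> (\<exists>G\<in>ball. F \<subset> G)" by (simp_all add: facets_def)
  then obtain a where a: "a \<in> M" "F \<subseteq> F_face n c a" by (auto simp only: mem_ball_iff)
  have "F_face n c a \<in> ball" using a(1) by (auto simp only: mem_ball_iff)
  then have "F = F_face n c a" using F(2) a(2) by blast
  then show "F \<in> F_face n c ` M" using a(1) by (rule image_eqI)
next
  fix F assume "F \<in> F_face n c ` M"
  then obtain a where a: "F = F_face n c a" "a \<in> M" by (rule imageE)
  have "\<not> F \<subset> G" if G: "G \<in> ball" for G
  proof
    assume sub: "F \<subset> G"
    obtain b where b: "b \<in> M" "G \<subseteq> F_face n c b"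
      using G by (auto simp only: mem_ball_iff)
    then have "a = b"
      using sub a by (intro F_face_subset_imp_eq[OF M_c_monomials M_c_monomials]) auto
    then show False using sub a(1) b(2) by blast
  qed
  moreover have "F \<in> ball" using a by (auto simp only: mem_ball_iff)
  ultimately show "F \<in> facets ball" by (auto simp only: facets_def)
qed

lemma ball_eq_Union_lower_intervals: "ball = (\<Union>a\<in>M. {lower_face n a..F_face n c a})"
proof
  show "(\<Union>a\<in>M. {lower_face n a..F_face n c a}) \<subseteq> ball"
    by (force simp: mem_ball_iff)
  show "ball \<subseteq> (\<Union>a\<in>M. {lower_face n a..F_face n c a})"
  proof
    fix S assume "S \<in> ball"
    then obtain b where b: "b \<in> M" "S \<subseteq> F_face n c b" by (auto simp: mem_ball_iff)
    \<comment> \<open>The minimum exists because \<open>(i, b i)\<close> is missing from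
      \<open>S\<close>. It is at most \<open>b i\<close>, so \<open>a\<close> divides
      \<open>b\<close> and therefore stays in \<open>M\<close>.\<close>
    define a where "a i = (if i \<in> {1..n} then LEAST j. (i, j) \<notin> S else 0)" for i
    have bS: "(i, b i) \<notin> S" for i using b(2) by (auto simp: mem_F_face_iff)
    have a_le: "a i \<le> b i" for i
      using bS by (auto simp: a_def intro: Least_le)
    have aS: "(i, a i) \<notin> S" if "i \<in> {1..n}" for i
      using that bS LeastI[of "\<lambda>j. (i, j) \<notin> S" "b i"] by (simp add: a_def)
    have "(i, j) \<in> S" if "i \<in> {1..n}" "j < a i" for i j
      using that not_less_Least[of j "\<lambda>j. (i, j) \<notin> S"] by (auto simp: a_def)
    then have "lower_face n a \<subseteq> S" by (auto simp: lower_face_def)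
    moreover have "S \<subseteq> F_face n c a"
      using b(2) aS by (auto simp: subset_iff mem_F_face_iff)
    moreover have "a \<in> M" using M_divisor_closed b(1) a_le by blast
    ultimately show "S \<in> (\<Union>a\<in>M. {lower_face n a..F_face n c a})" by auto
  qed
qed

lemma finite_interval: "finite {R..F_face n c a}"
  by (rule finite_subset[of _ "Pow (F_face n c a)"]) (auto simp: finite_F_face)

lemma sum_interval_faces:
  assumes "a \<in> M" "R \<subseteq> F_face n c a"
  shows "(\<Sum>S\<in>{R..F_face n c a}. [:-1, 1:] ^ (total - card S) :: int poly) = monom 1 (total - card R)"
proof -
  \<comment> \<open>Here \<open>[:0, 1:]\<close> is the variable \<open>t\<close>; all facets have
    \<open>total\<close> elements, so the interval formula applies with
    \<open>x = t\<close>.\<close>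
  have "[:-1, 1:] = [:0, 1:] - (1 :: int poly)" by (simp add: one_pCons)
  then have "(\<Sum>S\<in>{R..F_face n c a}. [:-1, 1:] ^ (total - card S) :: int poly) = [:0, 1:] ^ (total - card R)"
    using sum_interval_power[OF finite_F_face assms(2), of "[:0, 1:] :: int poly"]
    by (simp add: card_F_face M_c_monomials[OF assms(1)])
  then show ?thesis by (simp add: monom_altdef)
qed

lemma sum_ball:
  "(\<Sum>S\<in>ball. [:-1, 1:] ^ (total - card S) :: int poly) = (\<Sum>a\<in>M. monom 1 (total - monom_deg n a))"
proof -
  have "(\<Sum>S\<in>ball. [:-1, 1:] ^ (total - card S) :: int poly)
      = (\<Sum>a\<in>M. \<Sum>S\<in>{lower_face n a..F_face n c a}. [:-1, 1:] ^ (total - card S))"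
    unfolding ball_eq_Union_lower_intervals
    using finite_M finite_interval lower_intervals_disjoint[of _ n c] M_c_monomials
    by (intro sum.UNION_disjoint) (blast+)
  then show ?thesis
    by (simp add: sum_interval_faces lower_face_subset_F_face M_c_monomials card_lower_face)
qed

lemma sum_interior:
  "(\<Sum>S\<in>interior. [:-1, 1:] ^ (total - card S) :: int poly) = (\<Sum>a\<in>M. monom 1 (monom_deg n a))"
proof -
  have "(\<Sum>S\<in>interior. [:-1, 1:] ^ (total - card S) :: int poly)
      = (\<Sum>a\<in>M. \<Sum>S\<in>{upper_face n c a..F_face n c a}. [:-1, 1:] ^ (total - card S))"
    unfolding interior_def
    using finite_M finite_interval upper_intervals_disjoint[of _ n c] M_c_monomials
    by (intro sum.UNION_disjoint) (blast+)
  also have "\<dots> = (\<Sum>a\<in>M. monom 1 (monom_deg n a))"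
    using monom_deg_le[OF M_c_monomials]
    by (intro sum.cong refl) (simp add: sum_interval_faces upper_face_subset_F_face M_c_monomials card_upper_face)
  finally show ?thesis .
qed

lemma coeff_sum_monom_deg:
  "coeff (\<Sum>a\<in>M. monom (1::int) (monom_deg n a)) i = int (f_multi n M i)"
  using finite_M by (simp add: coeff_sum f_multi_def sum.If_cases Int_def)

lemma coeff_sum_monom_codeg:
  assumes "i \<le> total"
  shows "coeff (\<Sum>a\<in>M. monom (1::int) (total - monom_deg n a)) (total - i) = int (f_multi n M i)"
proof -
  have "coeff (\<Sum>a\<in>M. monom (1::int) (total - monom_deg n a)) (total - i)
      = (\<Sum>a\<in>M. if monom_deg n a = i then 1 else 0)"
    unfolding coeff_sum
  proof (rule sum.cong)
    fix a assume "a \<in> M"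
    then have "monom_deg n a \<le> total" using monom_deg_le M_c_monomials by blast
    \<comment> \<open>Both degrees are at most \<open>total\<close>, so the truncated subtraction
      can be cancelled.\<close>
    then have "total - monom_deg n a = total - i \<longleftrightarrow> monom_deg n a = i"
      using assms by linarith
    then show "coeff (monom (1::int) (total - monom_deg n a)) (total - i)
        = (if monom_deg n a = i then 1 else 0)" by simp
  qed simp
  then show ?thesis
    using finite_M by (simp add: f_multi_def sum.If_cases Int_def)
qed

text \<open>Matches the range beyond the rank, where \<open>h_vec\<close> is \<open>0\<close> by
  convention.\<close>

lemma f_multi_eq_0:
  assumes "total < i"
  shows "f_multi n M i = 0"
proof -
  have "{a \<in> M. monom_deg n a = i} = {}"
    using assms monom_deg_le[OF M_c_monomials] by fastforce
  then show ?thesis unfolding f_multi_def by (simp only: card.empty)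
qed

theorem h_vec_ball: "h_vec ball i = int (f_multi n M i)"
  using coeff_sum_monom_codeg f_multi_eq_0
  by (simp add: h_vec_def complex_rank_ball h_poly_eq_sum_faces finite_ball sum_ball
     )

section \<open>Boundary faces as the non-interior faces\<close>

lemma interior_subset_ball: "interior \<subseteq> ball"
  by (force simp: interior_def mem_ball_iff)

lemma Bier_face_iff:
  "S \<in> Bier n c M \<longleftrightarrow>
     (\<exists>S0. S \<subseteq> S0 \<and> card S0 + 1 = total \<and> (\<exists>!F. F \<in> F_face n c ` M \<and> S0 \<subseteq> F))"
proof -
  have "S0 \<in> ball" if "\<exists>!F. F \<in> F_face n c ` M \<and> S0 \<subseteq> F" for S0
    using that unfolding mem_ball_iff by (elim ex1E conjE imageE) blast
  then show ?thesis
    unfolding Bier_def boundary_complex_def generated_complex_def complex_rank_ball facets_ball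
      mem_Collect_eq Bex_def by (intro iffI; elim exE conjE; intro exI conjI)
qed

text \<open>A ridge \<open>S0\<close> containing \<open>upper_face n c b\<close> misses only
  vertices at height at most that of \<open>b\<close>. Exchanging one coordinate of the facet above
  \<open>S0\<close> thus gives a divisor of \<open>b\<close>, which belongs to \<open>M\<close> and
  yields a second facet above \<open>S0\<close>.\<close>

lemma Bier_disjoint_interior:
  assumes "S \<in> Bier n c M"
  shows "S \<notin> interior"
proof
  assume "S \<in> interior"
  then obtain b where b: "b \<in> M" "upper_face n c b \<subseteq> S" by (auto simp: interior_def)
  obtain S0 where S0: "S \<subseteq> S0" "card S0 + 1 = total" "\<exists>!F. F \<in> F_face n c ` M \<and> S0 \<subseteq> F"
    using assms[unfolded Bier_face_iff] by (elim exE conjE)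
  then obtain a where a: "a \<in> M" "S0 \<subseteq> F_face n c a" by blast
  have ac: "a \<in> c_monomials n c" using a(1) M_c_monomials by blast
  have "S0 \<noteq> F_face n c a" using S0(2) card_F_face[OF ac] by auto
  then obtain i j where ij: "(i, j) \<in> F_face n c a" "(i, j) \<notin> S0" using a(2) by auto
  then have i: "i \<in> {1..n}" "j \<le> c i" "j \<noteq> a i" by (auto simp: mem_F_face_iff)
  have le_b: "l \<le> b k" if "k \<in> {1..n}" "l \<le> c k" "(k, l) \<notin> S0" for k l
  proof (rule ccontr)
    assume "\<not> l \<le> b k"
    then have "(k, l) \<in> upper_face n c b" using that by (simp add: upper_face_def)
    then show False using that b(2) S0(1) by blast
  qed
  \<comment> \<open>The neighbouring facet across the ridge: it omits \<open>(i, j)\<close> in place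
    of \<open>(i, a i)\<close>.\<close>
  let ?a' = "a(i := j)"
  have "?a' k \<le> b k" for k
  proof (cases "k \<in> {1..n}")
    case True
    then have "a k \<le> c k" "(k, a k) \<notin> S0"
      using ac a(2) by (auto simp: c_monomials_def mem_F_face_iff subset_iff)
    then show ?thesis using True le_b ij i by auto
  next
    case False
    then show ?thesis using ac i by (auto simp: c_monomials_def)
  qed
  then have a': "?a' \<in> M" using M_divisor_closed b(1) by blast
  have "S0 \<subseteq> F_face n c ?a'"
    using a(2) ij(2) by (auto simp: subset_iff mem_F_face_iff)
  then have "F_face n c ?a' = F_face n c a" using S0(3) a a' by blast
  then have "?a' = a" using F_face_subset_imp_eq a' a(1) M_c_monomials by blast
  then show False using i(3) by (metis fun_upd_same)
qed

text \<open>Take a facet \<open>F_face a \<supseteq> S\<close> with \<open>a \<in> M\<close> of maximal degree: raising one exponent of \<open>a\<close>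
  while avoiding \<open>S\<close> leaves \<open>M\<close>, so the ridge crossed lies in no other facet.\<close>

lemma noninterior_in_Bier:
  assumes "S \<in> ball" "S \<notin> interior"
  shows "S \<in> Bier n c M"
proof -
  let ?A = "{a \<in> M. S \<subseteq> F_face n c a}"
  have "finite ?A" "?A \<noteq> {}" using finite_M assms(1) by (auto simp: mem_ball_iff)
  then obtain a where aA: "a \<in> ?A" and "monom_deg n a = Max (monom_deg n ` ?A)"
    by (metis (no_types, lifting) Max_in finite_imageI imageE image_is_empty)
  with \<open>finite ?A\<close> have max: "monom_deg n b \<le> monom_deg n a" if "b \<in> ?A" for b
    using that by simp
  have a: "a \<in> M" "S \<subseteq> F_face n c a" "a \<in> c_monomials n c" using aA M_c_monomials by auto
  have "\<not> upper_face n c a \<subseteq> S" using a assms(2) by (auto simp: interior_def)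
  then obtain i j where ij: "i \<in> {1..n}" "a i < j" "j \<le> c i" "(i, j) \<notin> S"
    unfolding upper_face_def by fastforce
  let ?a' = "a(i := j)"
  have a': "?a' \<notin> M"
  proof
    assume "?a' \<in> M"
    moreover have "S \<subseteq> F_face n c ?a'"
      using a(2) ij(4) by (auto simp: subset_iff mem_F_face_iff)
    ultimately have "monom_deg n ?a' \<le> monom_deg n a" using max by blast
    moreover have "monom_deg n a < monom_deg n ?a'"
      unfolding monom_deg_def using ij by (intro sum_strict_mono_ex1) auto
    ultimately show False by simp
  qed
  let ?S0 = "F_face n c a - {(i, j)}"
  have mem: "(i, j) \<in> F_face n c a" using ij by (simp add: mem_F_face_iff)
  have "card ?S0 + 1 = total"
    using card.remove[OF finite_F_face mem] card_F_face[OF a(3)] by simp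
  moreover have "S \<subseteq> ?S0" using a(2) ij(4) by auto
  moreover have "b = a" if b: "b \<in> M" "?S0 \<subseteq> F_face n c b" for b
  proof -
    have bc: "b \<in> c_monomials n c" using b(1) M_c_monomials by blast
    \<comment> \<open>The only vertices missing from \<open>?S0\<close> are the
      \<open>(k, a k)\<close> and \<open>(i, j)\<close>, so \<open>b\<close> is \<open>a\<close> or
      \<open>?a'\<close>; the latter is not in \<open>M\<close>.\<close>
    have cases: "b k = a k \<or> k = i \<and> b k = j" if "k \<in> {1..n}" for k
    proof -
      have "(k, b k) \<notin> ?S0" using b(2) mem_F_face_iff by blast
      moreover have "b k \<le> c k" using bc that by (simp add: c_monomials_def)
      ultimately show ?thesis using that by (auto simp: mem_F_face_iff)
    qed
    have "b i \<noteq> j"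
    proof
      assume "b i = j"
      then have "b k = ?a' k" for k
        using cases[of k] bc a(3) ij(1) by (cases "k \<in> {1..n}") (auto simp: c_monomials_def)
      then have "b = ?a'" by blast
      then show False using a' b(1) by simp
    qed
    then show "b = a"
      using cases by (intro eq_if_eq_on_columns[OF bc a(3)]) blast
  qed
  then have "\<exists>!F. F \<in> F_face n c ` M \<and> ?S0 \<subseteq> F"
    using a(1) by (intro ex1I[of _ "F_face n c a"]) auto
  ultimately show ?thesis unfolding Bier_face_iff by (intro exI[of _ ?S0] conjI)
qed

lemma Bier_eq: "Bier n c M = ball - interior"
proof -
  have "Bier n c M \<subseteq> ball" by (force simp: Bier_face_iff mem_ball_iff)
  then show ?thesis using Bier_disjoint_interior noninterior_in_Bier by blast
qed

end

section \<open>Proper multicomplexes and the g-vector of the sphere\<close>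

locale proper_multicomplex = multicomplex +
  assumes proper: "M \<noteq> c_monomials n c"
begin

text \<open>A monomial attaining every \<open>c i\<close> is divisible by all c-monomials, so its
  presence would make \<open>M\<close> the full set.\<close>

lemma ex_exponent_less: "a \<in> M \<Longrightarrow> \<exists>i\<in>{1..n}. a i < c i"
proof (rule ccontr)
  assume a: "a \<in> M" and "\<not> (\<exists>i\<in>{1..n}. a i < c i)"
  then have ge: "c i \<le> a i" if "i \<in> {1..n}" for i using that by force
  have "b \<in> M" if "b \<in> c_monomials n c" for b
  proof (rule M_divisor_closed[OF a])
    fix i show "b i \<le> a i"
      using that ge[of i] unfolding c_monomials_def
      by (cases "i \<in> {1..n}") (auto intro: order_trans)
  qed
  then show False using proper M_c_monomials by blast
qed

lemma f_multi_total: "f_multi n M total = 0"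
proof -
  have "monom_deg n a < total" if "a \<in> M" for a
    unfolding monom_deg_def using that ex_exponent_less[OF that] M_c_monomials[OF that]
    by (intro sum_strict_mono_ex1) (auto simp: c_monomials_def)
  then have "{a \<in> M. monom_deg n a = total} = {}" by fastforce
  then show ?thesis unfolding f_multi_def by (simp only: card.empty)
qed

lemma f_multi_0: "f_multi n M 0 = 1"
proof -
  obtain a where "a \<in> M" using M_nonempty by blast
  then have "(\<lambda>_. 0) \<in> M" by (rule M_divisor_closed) simp
  moreover have "a = (\<lambda>_. 0)" if "a \<in> M" "monom_deg n a = 0" for a
    using that M_c_monomials[of a] by (intro ext) (auto simp: monom_deg_def c_monomials_def)
  moreover have "monom_deg n (\<lambda>_. 0) = 0" by (simp add: monom_deg_def)
  ultimately have "{a \<in> M. monom_deg n a = 0} = {\<lambda>_. 0}" by blast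
  then show ?thesis by (simp add: f_multi_def)
qed

lemma finite_Bier: "finite (Bier n c M)"
  using finite_ball by (simp add: Bier_eq)

text \<open>By properness every \<open>upper_face n c a\<close> with \<open>a\<close> in
  \<open>M\<close> is nonempty, so the empty face is not interior. It is then a boundary face and
  must lie in some boundary ridge.\<close>

lemma Bier_ridge: "\<exists>S\<in>Bier n c M. card S + 1 = total"
proof -
  have "{} \<in> ball" using M_nonempty by (auto simp: mem_ball_iff)
  moreover have "{} \<notin> interior"
    using ex_exponent_less by (fastforce simp: interior_def upper_face_def)
  ultimately have "{} \<in> Bier n c M" by (simp add: Bier_eq)
  then obtain S where S: "card S + 1 = total" "\<exists>!F. F \<in> F_face n c ` M \<and> S \<subseteq> F"
    unfolding Bier_face_iff by (elim exE conjE)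
  then have "S \<in> Bier n c M"
    unfolding Bier_face_iff by (intro exI[of _ S] conjI order_refl)
  then show ?thesis using S(1) by blast
qed

lemma card_Bier_le: "S \<in> Bier n c M \<Longrightarrow> card S + 1 \<le> total"
proof -
  assume "S \<in> Bier n c M"
  then obtain S0 where S0: "S \<subseteq> S0" "card S0 + 1 = total"
      "\<exists>!F. F \<in> F_face n c ` M \<and> S0 \<subseteq> F"
    unfolding Bier_face_iff by (elim exE conjE)
  then have "finite S0" using finite_F_face by (metis finite_subset imageE)
  then have "card S \<le> card S0" using S0(1) by (rule card_mono)
  then show ?thesis using S0(2) by linarith
qed

lemma total_pos: "0 < total"
  using Bier_ridge by (elim bexE) linarith

lemma complex_rank_Bier: "complex_rank (Bier n c M) = total - 1"
proof -
  obtain S where S: "S \<in> Bier n c M" "card S + 1 = total" using Bier_ridge by blast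
  show ?thesis
  proof (rule complex_rank_eqI[OF finite_Bier _ S(1)])
    show "card T \<le> total - 1" if "T \<in> Bier n c M" for T
      using card_Bier_le[OF that] by linarith
    show "card S = total - 1" using S(2) by linarith
  qed
qed

text \<open>The sphere has rank one less than the ball, so the factor \<open>t - 1\<close> aligns
  its exponents with those of the ball. The face sum is then that of the ball minus that of the
  interior.\<close>

lemma h_poly_Bier:
  "[:-1, 1:] * h_poly (Bier n c M)
    = (\<Sum>a\<in>M. monom 1 (total - monom_deg n a)) - (\<Sum>a\<in>M. monom 1 (monom_deg n a))"
proof -
  have "[:-1, 1:] * h_poly (Bier n c M) = (\<Sum>S\<in>Bier n c M. [:-1, 1:] ^ (total - card S))"
    unfolding h_poly_eq_sum_faces[OF finite_Bier] complex_rank_Bier sum_distrib_left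
  proof (rule sum.cong)
    fix S assume "S \<in> Bier n c M"
    then have "total - card S = Suc (total - 1 - card S)" using card_Bier_le by fastforce
    then show "[:-1, 1:] * [:-1, 1:] ^ (total - 1 - card S) = ([:-1, 1:] :: int poly) ^ (total - card S)"
      by simp
  qed simp
  also have "\<dots> = (\<Sum>S\<in>ball. [:-1, 1:] ^ (total - card S)) - (\<Sum>S\<in>interior. [:-1, 1:] ^ (total - card S))"
    unfolding Bier_eq by (rule sum_diff[OF finite_ball interior_subset_ball])
  finally show ?thesis by (simp only: sum_ball sum_interior)
qed

theorem g_vec_Bier:
  assumes "i < total"
  shows "g_vec (Bier n c M) i = int (f_multi n M i) - int (f_multi n M (total - i))"
proof (cases "i = 0")
  \<comment> \<open>\<open>g_vec\<close> is \<open>1\<close> here by convention, in agreement with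
    one monomial of degree \<open>0\<close> and none of degree \<open>total\<close>.\<close>
  case True
  then show ?thesis using f_multi_0 f_multi_total by (simp add: g_vec_def)
next
  case False
  let ?p = "h_poly (Bier n c M)"
  have suc: "total - i = Suc (total - 1 - i)" and pred: "total - 1 - (i - 1) = total - i"
    using False assms by linarith+
  have "g_vec (Bier n c M) i = coeff ?p (total - 1 - i) - coeff ?p (total - i)"
    using False assms pred by (simp add: g_vec_def h_vec_def complex_rank_Bier)
  \<comment> \<open>Multiplication by \<open>t - 1\<close> takes differences of neighbouring
    coefficients; in the reversed indexing of \<open>h_vec\<close> these are the
    \<open>g_vec\<close> entries.\<close>
  also have "\<dots> = coeff ([:-1, 1:] * ?p) (total - i)"
    unfolding suc by simp
  also have "\<dots> = int (f_multi n M i) - int (f_multi n M (total - i))"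
    unfolding h_poly_Bier coeff_diff coeff_sum_monom_deg
    using coeff_sum_monom_codeg[of i] assms by simp
  finally show ?thesis .
qed

end

theorem theorem1p14:
  fixes n :: nat and c :: "nat \<Rightarrow> nat" and M :: "(nat \<Rightarrow> nat) set"
  assumes "proper_c_multicomplex n c M"
  shows "(\<forall>i. h_vec (bier_ball n c M) i = int (f_multi n M i)) \<and>
         (\<forall>i \<le> ((\<Sum>k=1..n. c k) - 1) div 2.
            g_vec (Bier n c M) i = int (f_multi n M i) - int (f_multi n M ((\<Sum>k=1..n. c k) - i)))"
proof -
  interpret proper_multicomplex n c M
    using assms by unfold_locales (auto simp: proper_c_multicomplex_def)
  \<comment> \<open>Positivity of \<open>total\<close> matters: for \<open>total = 0\<close> the
    truncated bound would still admit \<open>i = 0\<close>.\<close>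
  have "i < total" if "i \<le> (total - 1) div 2" for i
    using that total_pos by linarith
  then show ?thesis using h_vec_ball g_vec_Bier by blast
qed

end
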